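(* Let $E$ be an elliptic curve over $K$ with $j$-invariant $j$. Then $E$ has split multiplicative reduction over a (finite) extension of $K$ if and only if $v(j)<0$.
   Context: $K$ is a complete discretely valued field of characteristic zero with normalized valuation $v$, and algebraically closed residue field whose characteristic is coprime to six. Having multiplicative reduction over an extension of $K$ is equivalent to $E$ admitting, over the valuation ring $R'$ of some finite extension of $K$, a semistable model whose intersection graph has first Betti number one. *)

theory Defs
  imports "HOL-Algebra.Algebraic_Closure_Type" "HOL-Library.Extended_Real"
begin

section \<open>Discrete valuations\<close>

text \<open>
  The fields considered are subsets of a field type: the ground field \<open>K\<close> is a whole type
  (\<open>F = UNIV\<close>), and its algebraic extensions are subfields of \<^typ>\<open>'a alg_closure\<close>.
  The values of a valuation outside \<open>F\<close> are irrelevant.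
\<close>

definition normalized_valuation_on :: "'b::field set \<Rightarrow> ('b \<Rightarrow> ereal) \<Rightarrow> bool" where
  "normalized_valuation_on F w \<longleftrightarrow>
     (\<forall>x\<in>F. w x = \<infinity> \<longleftrightarrow> x = 0) \<and>
     (\<forall>x\<in>F. \<forall>y\<in>F. w (x * y) = w x + w y) \<and>
     (\<forall>x\<in>F. \<forall>y\<in>F. min (w x) (w y) \<le> w (x + y)) \<and>
     w ` (F - {0}) = range (\<lambda>n::int. ereal (real_of_int n))"

definition complete_valuation :: "('a::field \<Rightarrow> ereal) \<Rightarrow> bool" where
  "complete_valuation v \<longleftrightarrow>
     (\<forall>s :: nat \<Rightarrow> 'a.
        (\<forall>c::real. \<exists>N. \<forall>i\<ge>N. \<forall>j\<ge>N. ereal c \<le> v (s i - s j)) \<longrightarrow>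
        (\<exists>x. \<forall>c::real. \<exists>N. \<forall>i\<ge>N. ereal c \<le> v (s i - x)))"

definition valuation_ring :: "'b::field set \<Rightarrow> ('b \<Rightarrow> ereal) \<Rightarrow> 'b ring" where
  "valuation_ring F w = ring_of_type_algebra\<lparr>carrier := {x \<in> F. 0 \<le> w x}\<rparr>"

definition valuation_ideal :: "'b::field set \<Rightarrow> ('b \<Rightarrow> ereal) \<Rightarrow> 'b set" where
  "valuation_ideal F w = {x \<in> F. 0 < w x}"

definition residue_field :: "'b::field set \<Rightarrow> ('b \<Rightarrow> ereal) \<Rightarrow> 'b set ring" where
  "residue_field F w = valuation_ring F w Quot valuation_ideal F w"

text \<open>The additive order of \<open>1\<close>; it is \<open>0\<close> if that order is infinite.\<close>

definition ring_characteristic :: "('c, 'm) ring_scheme \<Rightarrow> nat" where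
  "ring_characteristic k = group.ord (add_monoid k) \<one>\<^bsub>k\<^esub>"

section \<open>Finite extensions\<close>

text \<open>
  Every finite extension of \<open>K\<close> embeds over \<open>K\<close> into the algebraic closure.  The valuation \<open>w\<close> on
  \<open>L\<close> is again normalized, so it restricts to a multiple of \<open>v\<close> (the ramification index).
\<close>

definition finite_extension :: "'a::field alg_closure set \<Rightarrow> bool" where
  "finite_extension L \<longleftrightarrow>
     subfield L ring_of_type_algebra \<and> range (to_ac :: 'a \<Rightarrow> 'a alg_closure) \<subseteq> L \<and>
     ring.finite_dimension ring_of_type_algebra (range (to_ac :: 'a \<Rightarrow> 'a alg_closure)) L"

definition extends_valuation ::
    "('a::field \<Rightarrow> ereal) \<Rightarrow> 'a alg_closure set \<Rightarrow> ('a alg_closure \<Rightarrow> ereal) \<Rightarrow> bool" where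
  "extends_valuation v L w \<longleftrightarrow>
     normalized_valuation_on L w \<and>
     (\<exists>e::nat. 0 < e \<and> (\<forall>x. w (to_ac x) = ereal (real e) * v x))"

section \<open>Weierstrass equations\<close>

text \<open>The equation \<open>y\<^sup>2 + a1 x y + a3 y = x\<^sup>3 + a2 x\<^sup>2 + a4 x + a6\<close>.\<close>

datatype 'b weierstrass = Weierstrass (a1: 'b) (a2: 'b) (a3: 'b) (a4: 'b) (a6: 'b)

definition b2 :: "'b::comm_ring_1 weierstrass \<Rightarrow> 'b" where
  "b2 E = a1 E ^ 2 + 4 * a2 E"

definition b4 :: "'b::comm_ring_1 weierstrass \<Rightarrow> 'b" where
  "b4 E = 2 * a4 E + a1 E * a3 E"

definition b6 :: "'b::comm_ring_1 weierstrass \<Rightarrow> 'b" where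
  "b6 E = a3 E ^ 2 + 4 * a6 E"

definition b8 :: "'b::comm_ring_1 weierstrass \<Rightarrow> 'b" where
  "b8 E = a1 E ^ 2 * a6 E + 4 * a2 E * a6 E - a1 E * a3 E * a4 E + a2 E * a3 E ^ 2 - a4 E ^ 2"

definition c4 :: "'b::comm_ring_1 weierstrass \<Rightarrow> 'b" where
  "c4 E = b2 E ^ 2 - 24 * b4 E"

definition discriminant :: "'b::comm_ring_1 weierstrass \<Rightarrow> 'b" where
  "discriminant E = - (b2 E ^ 2) * b8 E - 8 * b4 E ^ 3 - 27 * b6 E ^ 2 + 9 * b2 E * b4 E * b6 E"

definition elliptic_curve :: "'b::field weierstrass \<Rightarrow> bool" where
  "elliptic_curve E \<longleftrightarrow> discriminant E \<noteq> 0"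

definition j_invariant :: "'b::field weierstrass \<Rightarrow> 'b" where
  "j_invariant E = c4 E ^ 3 / discriminant E"

text \<open>
  \<open>E'\<close> arises from \<open>E\<close> by the substitution \<open>x = u\<^sup>2 x' + r\<close>, \<open>y = u\<^sup>3 y' + s u\<^sup>2 x' + t\<close>
  with \<open>u, r, s, t\<close> in \<open>F\<close>.
\<close>

definition isomorphic_over :: "'b::field set \<Rightarrow> 'b weierstrass \<Rightarrow> 'b weierstrass \<Rightarrow> bool" where
  "isomorphic_over F E E' \<longleftrightarrow>
     (\<exists>u\<in>F - {0}. \<exists>r\<in>F. \<exists>s\<in>F. \<exists>t\<in>F.
        u * a1 E' = a1 E + 2 * s \<and>
        u ^ 2 * a2 E' = a2 E - s * a1 E + 3 * r - s ^ 2 \<and>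
        u ^ 3 * a3 E' = a3 E + r * a1 E + 2 * t \<and>
        u ^ 4 * a4 E' = a4 E - s * a3 E + 2 * r * a2 E - (t + r * s) * a1 E + 3 * r ^ 2 - 2 * s * t \<and>
        u ^ 6 * a6 E' = a6 E + r * a4 E + r ^ 2 * a2 E + r ^ 3 - t * a3 E - t ^ 2 - r * t * a1 E)"

definition integral_model ::
    "'b::field set \<Rightarrow> ('b \<Rightarrow> ereal) \<Rightarrow> 'b weierstrass \<Rightarrow> 'b weierstrass \<Rightarrow> bool" where
  "integral_model F w E E' \<longleftrightarrow>
     isomorphic_over F E E' \<and> set_weierstrass E' \<subseteq> carrier (valuation_ring F w)"

definition minimal_model ::
    "'b::field set \<Rightarrow> ('b \<Rightarrow> ereal) \<Rightarrow> 'b weierstrass \<Rightarrow> 'b weierstrass \<Rightarrow> bool" where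
  "minimal_model F w E E' \<longleftrightarrow>
     integral_model F w E E' \<and>
     (\<forall>E''. integral_model F w E E'' \<longrightarrow> w (discriminant E') \<le> w (discriminant E''))"

section \<open>Split multiplicative reduction\<close>

definition reduction ::
    "'b::field set \<Rightarrow> ('b \<Rightarrow> ereal) \<Rightarrow> 'b weierstrass \<Rightarrow> 'b set weierstrass" where
  "reduction F w E =
     map_weierstrass (\<lambda>x. valuation_ideal F w +>\<^bsub>valuation_ring F w\<^esub> x) E"

text \<open>
  A singular point \<open>(x, y)\<close> which is a node with tangent slopes \<open>\<alpha> \<noteq> \<beta>\<close> in \<open>k\<close>: the equation and
  its partial derivatives vanish there, and its quadratic part
  \<open>Y\<^sup>2 + a1 X Y - (a2 + 3 x) X\<^sup>2\<close> at \<open>(x, y)\<close> is \<open>(Y - \<alpha> X) (Y - \<beta> X)\<close>.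
  The point at infinity of a Weierstrass cubic is always smooth.
\<close>

definition has_split_node :: "('c, 'm) ring_scheme \<Rightarrow> 'c weierstrass \<Rightarrow> bool" where
  "has_split_node k E \<longleftrightarrow>
     (\<exists>x\<in>carrier k. \<exists>y\<in>carrier k.
        (y [^]\<^bsub>k\<^esub> (2::nat)) \<oplus>\<^bsub>k\<^esub> (a1 E \<otimes>\<^bsub>k\<^esub> x \<otimes>\<^bsub>k\<^esub> y) \<oplus>\<^bsub>k\<^esub> (a3 E \<otimes>\<^bsub>k\<^esub> y) =
        (x [^]\<^bsub>k\<^esub> (3::nat)) \<oplus>\<^bsub>k\<^esub> (a2 E \<otimes>\<^bsub>k\<^esub> (x [^]\<^bsub>k\<^esub> (2::nat))) \<oplus>\<^bsub>k\<^esub> (a4 E \<otimes>\<^bsub>k\<^esub> x) \<oplus>\<^bsub>k\<^esub> a6 E \<and>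
        a1 E \<otimes>\<^bsub>k\<^esub> y =
        ([(3::nat)] \<cdot>\<^bsub>k\<^esub> (x [^]\<^bsub>k\<^esub> (2::nat))) \<oplus>\<^bsub>k\<^esub> ([(2::nat)] \<cdot>\<^bsub>k\<^esub> (a2 E \<otimes>\<^bsub>k\<^esub> x)) \<oplus>\<^bsub>k\<^esub> a4 E \<and>
        ([(2::nat)] \<cdot>\<^bsub>k\<^esub> y) \<oplus>\<^bsub>k\<^esub> (a1 E \<otimes>\<^bsub>k\<^esub> x) \<oplus>\<^bsub>k\<^esub> a3 E = \<zero>\<^bsub>k\<^esub> \<and>
        (\<exists>\<alpha>\<in>carrier k. \<exists>\<beta>\<in>carrier k. \<alpha> \<noteq> \<beta> \<and>
           \<alpha> \<oplus>\<^bsub>k\<^esub> \<beta> = \<ominus>\<^bsub>k\<^esub> (a1 E) \<and>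
           \<alpha> \<otimes>\<^bsub>k\<^esub> \<beta> = \<ominus>\<^bsub>k\<^esub> (a2 E \<oplus>\<^bsub>k\<^esub> ([(3::nat)] \<cdot>\<^bsub>k\<^esub> x))))"

definition split_multiplicative_reduction ::
    "'b::field set \<Rightarrow> ('b \<Rightarrow> ereal) \<Rightarrow> 'b weierstrass \<Rightarrow> bool" where
  "split_multiplicative_reduction F w E \<longleftrightarrow>
     (\<exists>E'. minimal_model F w E E' \<and> has_split_node (residue_field F w) (reduction F w E'))"

end

theory Submission
  imports Defs
begin

text \<open>
  The invariants \<open>c4\<close> and \<open>\<Delta>\<close> of a Weierstrass equation decide the question, because a change of
  coordinates multiplies them by fourth and twelfth powers of the scaling factor, so that
  \<open>j = c4\<^sup>3 / \<Delta>\<close> does not change at all.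

  If an integral equation has a node modulo the maximal ideal, move the node to the origin.  Then
  \<open>\<Delta>\<close> lies in the maximal ideal, and \<open>c4\<close> is congruent to the fourth power of the difference of the
  two tangent slopes, hence a unit (\<open>node_c4_discriminant\<close>).  So \<open>j\<close> has negative valuation over the
  extension \<open>L\<close>, and therefore over \<open>K\<close>, where the valuation only differs by a positive factor.

  Conversely let \<open>v j < 0\<close>.  Since \<open>2\<close> and \<open>3\<close> are units, \<open>E\<close> has an equation
  \<open>y\<^sup>2 = x\<^sup>3 + A x + B\<close>, and \<open>v j < 0\<close> says that \<open>4 A\<^sup>3 + 27 B\<^sup>2\<close> has larger valuation than
  \<open>A\<^sup>3\<close>.  This forces \<open>3 v A = 2 v B\<close>, that is, \<open>v A = 2 m\<close> and \<open>v B = 3 m\<close> for an integer \<open>m\<close>.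
  Scaling by \<open>u\<close> with \<open>u\<^sup>2 = \<pi>\<^sup>m\<close> makes both coefficients units; for odd \<open>m\<close> such a \<open>u\<close> exists only
  after adjoining a square root of the uniformizer \<open>\<pi>\<close>, and \<open>L = K(\<surd>\<pi>)\<close> serves for every \<open>m\<close>.
  The scaled coefficients \<open>A / \<pi>\<^bsup>2m\<^esup>\<close> and \<open>B / \<pi>\<^bsup>3m\<^esup>\<close> lie in \<open>K\<close>.  Hence the node and its slopes
  can be found over the residue field of \<open>K\<close>, where algebraic closedness supplies the square root
  that the slopes need (\<open>short_split_node\<close>).  The scaled equation is minimal because its \<open>c4\<close> is a
  unit (\<open>minimal_modelI\<close>).

  On \<open>L = K \<oplus> K \<surd>\<pi>\<close> the valuation is \<open>v\<close> of the norm \<open>a\<^sup>2 - \<pi> b\<^sup>2\<close> of \<open>a + b \<surd>\<pi>\<close>.  The two terms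
  have valuations of different parity, so nothing cancels, and all the properties of a normalized
  valuation can be read off (locale \<open>uniformizer_square_root\<close>).
\<close>

section \<open>Subfields of a field type\<close>

lemma ring_of_type_algebra_simps [simp]:
  "carrier ring_of_type_algebra = UNIV"
  "x \<otimes>\<^bsub>ring_of_type_algebra\<^esub> y = x * y"
  "x \<oplus>\<^bsub>ring_of_type_algebra\<^esub> y = x + y"
  "\<one>\<^bsub>ring_of_type_algebra\<^esub> = 1"
  "\<zero>\<^bsub>ring_of_type_algebra\<^esub> = 0"
  by (simp_all add: ring_of_type_algebra_def)

lemma ring_of_type_algebra_uminus [simp]:
  "\<ominus>\<^bsub>ring_of_type_algebra\<^esub> x = - (x :: 'b::field)"
proof -
  interpret field "ring_of_type_algebra :: 'b ring" by (rule field_from_type_algebra)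
  show ?thesis using minus_equality[of "- x" x] by simp
qed

lemma ring_of_type_algebra_inverse [simp]:
  assumes "x \<noteq> 0"
  shows "inv\<^bsub>ring_of_type_algebra\<^esub> x = inverse (x :: 'b::field)"
proof -
  interpret field "ring_of_type_algebra :: 'b ring" by (rule field_from_type_algebra)
  show ?thesis using inv_unique'[of x "inverse x"] assms by simp
qed

lemma subfield_of_typeI:
  fixes F :: "'b::field set"
  assumes "1 \<in> F" "\<And>x y. x \<in> F \<Longrightarrow> y \<in> F \<Longrightarrow> x + y \<in> F" "\<And>x. x \<in> F \<Longrightarrow> - x \<in> F"
    "\<And>x y. x \<in> F \<Longrightarrow> y \<in> F \<Longrightarrow> x * y \<in> F" "\<And>x. x \<in> F \<Longrightarrow> x \<noteq> 0 \<Longrightarrow> inverse x \<in> F"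
  shows "subfield F ring_of_type_algebra"
proof -
  interpret field "ring_of_type_algebra :: 'b ring" by (rule field_from_type_algebra)
  show ?thesis by (rule subfieldI'[OF subringI]) (use assms in auto)
qed

lemma subfield_of_typeD:
  fixes F :: "'b::field set"
  assumes "subfield F ring_of_type_algebra"
  shows "1 \<in> F" "0 \<in> F" "x \<in> F \<Longrightarrow> y \<in> F \<Longrightarrow> x + y \<in> F" "x \<in> F \<Longrightarrow> - x \<in> F"
    "x \<in> F \<Longrightarrow> y \<in> F \<Longrightarrow> x * y \<in> F" "x \<in> F \<Longrightarrow> inverse x \<in> F"
proof -
  interpret field "ring_of_type_algebra :: 'b ring" by (rule field_from_type_algebra)
  note sub = subringE[OF subfieldE(1)[OF assms]]
  show "1 \<in> F" and zero: "0 \<in> F" using sub(2,3) by auto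
  show "x \<in> F \<Longrightarrow> y \<in> F \<Longrightarrow> x + y \<in> F" "x \<in> F \<Longrightarrow> - x \<in> F"
    "x \<in> F \<Longrightarrow> y \<in> F \<Longrightarrow> x * y \<in> F"
    using sub(5)[of x] sub(6)[of x y] sub(7)[of x y] by auto
  show "x \<in> F \<Longrightarrow> inverse x \<in> F"
    using subfield_m_inv(1)[OF assms, of x] zero by (cases "x = 0") auto
qed

section \<open>Valued fields\<close>

text \<open>The ground field and its extension enter the argument in the same way: each is a subfield of
  a field type with a normalized valuation on it.  Facts about reduction are therefore proved for
  both at once.\<close>

locale valued_subfield =
  fixes F :: "'b::field set" and w :: "'b \<Rightarrow> ereal"
  assumes subfield: "subfield F ring_of_type_algebra"
    and normalized: "normalized_valuation_on F w"
begin

lemmas closed [simp] = subfield_of_typeD[OF subfield]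

lemma diff_closed [simp]: "x \<in> F \<Longrightarrow> y \<in> F \<Longrightarrow> x - y \<in> F"
  using closed(3)[of x "- y"] by simp

lemma divide_closed [simp]: "x \<in> F \<Longrightarrow> y \<in> F \<Longrightarrow> x / y \<in> F"
  by (simp add: divide_inverse)

lemma power_closed [simp]: "x \<in> F \<Longrightarrow> x ^ n \<in> F"
  by (induction n) auto

lemma power_int_closed [simp]: "x \<in> F \<Longrightarrow> x powi n \<in> F"
  by (simp add: power_int_def)

lemma of_nat_closed [simp]: "of_nat n \<in> F"
  by (induction n) auto

lemma numeral_closed [simp]: "numeral n \<in> F"
  using of_nat_closed[of "numeral n"] by simp

lemma val_eq_infinity_iff [simp]: "x \<in> F \<Longrightarrow> w x = \<infinity> \<longleftrightarrow> x = 0"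
  and val_mult [simp]: "x \<in> F \<Longrightarrow> y \<in> F \<Longrightarrow> w (x * y) = w x + w y"
  and val_add_ge: "x \<in> F \<Longrightarrow> y \<in> F \<Longrightarrow> min (w x) (w y) \<le> w (x + y)"
  and val_image: "w ` (F - {0}) = range (\<lambda>n::int. ereal (real_of_int n))"
  using normalized by (auto simp: normalized_valuation_on_def)

lemma val_0 [simp]: "w 0 = \<infinity>"
  by simp

lemma val_int: assumes "x \<in> F" "x \<noteq> 0" obtains n :: int where "w x = ereal (real_of_int n)"
  proof -
  have "w x \<in> range (\<lambda>n::int. ereal (real_of_int n))"
    using assms by (simp flip: val_image)
  then show thesis
    using that by blast
qed

lemma element_of_val: obtains x where "x \<in> F" "x \<noteq> 0" "w x = ereal (real_of_int n)"
proof -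
  have "ereal (real_of_int n) \<in> w ` (F - {0})"
    unfolding val_image by blast
  then obtain y where "y \<in> F - {0}" "ereal (real_of_int n) = w y"
    by (rule imageE)
  then show thesis
    using that[of y] by simp
qed

lemma val_1 [simp]: "w 1 = 0"
proof -
  obtain n :: int where n: "w 1 = ereal (real_of_int n)"
    using val_int[of 1] by auto
  have "w (1 * 1) = w 1 + w 1" by (rule val_mult) auto
  with n show ?thesis by auto
qed

lemma val_minus [simp]: assumes "x \<in> F" shows "w (- x) = w x"
proof -
  obtain n :: int where n: "w (- 1) = ereal (real_of_int n)"
    using val_int[of "- 1"] by auto
  have "w (- 1 * - 1) = w (- 1) + w (- 1)" by (rule val_mult) auto
  with n have "w (- 1) = 0" by (auto simp flip: of_int_add)
  thus ?thesis using val_mult[of "- 1" x] assms by simp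
qed

lemma val_divide:
  assumes "x \<in> F" "y \<in> F" "y \<noteq> 0"
  shows "w (x / y) = w x - w y"
proof -
  have "w x = w (x / y) + w y"
    using val_mult[of "x / y" y] assms by simp
  moreover obtain n :: int where "w y = ereal (real_of_int n)"
    using val_int assms by auto
  ultimately show ?thesis by (cases "w (x / y)") auto
qed

lemma val_power [simp]: "x \<in> F \<Longrightarrow> w (x ^ n) = ereal (real n) * w x"
proof (induction n)
  case (Suc n)
  have "w (x ^ Suc n) = w x + ereal (real n) * w x"
    using Suc by simp
  also have "\<dots> = ereal (real (Suc n)) * w x"
  proof (cases "x = 0")
    case False
    then obtain k :: int where "w x = ereal (real_of_int k)"
      using val_int Suc by blast
    then show ?thesis by (simp add: algebra_simps)
  qed auto
  finally show ?case .
qed auto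

lemma val_power_int:
  assumes "x \<in> F" "x \<noteq> 0" "w x = ereal r"
  shows "w (x powi n) = ereal (real_of_int n * r)"
proof (cases "n \<ge> 0")
  case True
  thus ?thesis using assms by (simp add: power_int_def)
next
  case False
  thus ?thesis
    using assms val_divide[of 1 "x ^ nat (- n)"] 
    by (simp add: power_int_def divide_inverse power_inverse zero_ereal_def)
qed

text \<open>If \<open>x + y\<close> had valuation larger than the smaller one of \<open>w x\<close> and \<open>w y\<close>, then the summand
  with the smaller valuation would be a difference of two elements of larger valuation.\<close>

lemma val_add_eq_min:
  assumes "x \<in> F" "y \<in> F" "w x \<noteq> w y"
  shows "w (x + y) = min (w x) (w y)"
proof -
  have *: "w (a + b) = w a" if "a \<in> F" "b \<in> F" "w a < w b" for a b
  proof -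
    have "min (w (a + b)) (w (- b)) \<le> w (a + b + - b)"
      using that by (intro val_add_ge) auto
    moreover have "min (w a) (w b) \<le> w (a + b)"
      using that by (intro val_add_ge) auto
    ultimately show ?thesis using that by (auto simp: min_def split: if_splits)
  qed
  show ?thesis
    using *[of x y] *[of y x] assms
    by (cases "w x < w y") (auto simp: min_def add.commute)
qed

subsection \<open>The valuation ring, its ideal and the residue field\<close>

abbreviation R where "R \<equiv> valuation_ring F w"
abbreviation \<m> where "\<m> \<equiv> valuation_ideal F w"
abbreviation \<k> where "\<k> \<equiv> residue_field F w"
abbreviation res where "res x \<equiv> \<m> +>\<^bsub>R\<^esub> x"

lemma R_simps [simp]:
  "x \<in> carrier R \<longleftrightarrow> x \<in> F \<and> 0 \<le> w x"
  "x \<otimes>\<^bsub>R\<^esub> y = x * y" "x \<oplus>\<^bsub>R\<^esub> y = x + y" "\<one>\<^bsub>R\<^esub> = 1" "\<zero>\<^bsub>R\<^esub> = 0"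
  by (simp_all add: valuation_ring_def ring_of_type_algebra_def)

lemma integral_add: "x \<in> carrier R \<Longrightarrow> y \<in> carrier R \<Longrightarrow> x + y \<in> carrier R"
  using val_add_ge[of x y] by (auto simp: min_def split: if_splits)

lemma integral_minus: "x \<in> carrier R \<Longrightarrow> - x \<in> carrier R"
  by simp

lemma integral_diff: "x \<in> carrier R \<Longrightarrow> y \<in> carrier R \<Longrightarrow> x - y \<in> carrier R"
  using integral_add[of x "- y"] by simp

lemma integral_mult: "x \<in> carrier R \<Longrightarrow> y \<in> carrier R \<Longrightarrow> x * y \<in> carrier R"
  by simp

lemma integral_power: "x \<in> carrier R \<Longrightarrow> x ^ n \<in> carrier R"
  by simp

lemma integral_of_nat: "of_nat n \<in> carrier R"
proof (induction n)
  case (Suc n)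
  then show ?case using integral_add[of 1 "of_nat n"] by simp
qed simp

lemma integral_numeral: "numeral n \<in> carrier R"
  using integral_of_nat[of "numeral n"] by simp

lemmas integral_intros = integral_add integral_minus integral_diff integral_mult integral_power
  integral_numeral

lemma ideal_iff: "x \<in> \<m> \<longleftrightarrow> x \<in> F \<and> 0 < w x"
  by (simp add: valuation_ideal_def)

lemma ideal_add: "x \<in> \<m> \<Longrightarrow> y \<in> \<m> \<Longrightarrow> x + y \<in> \<m>"
  using val_add_ge[of x y] by (auto simp: ideal_iff min_def split: if_splits)

lemma ideal_minus: "x \<in> \<m> \<Longrightarrow> - x \<in> \<m>"
  by (simp add: ideal_iff)

lemma ideal_diff: "x \<in> \<m> \<Longrightarrow> y \<in> \<m> \<Longrightarrow> x - y \<in> \<m>"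
  using ideal_add[of x "- y"] ideal_minus by simp

lemma ideal_mult_left: "x \<in> carrier R \<Longrightarrow> y \<in> \<m> \<Longrightarrow> x * y \<in> \<m>"
  using add_nonneg_pos[of "w x" "w y"] by (simp add: ideal_iff)

lemma ideal_mult_right: "x \<in> \<m> \<Longrightarrow> y \<in> carrier R \<Longrightarrow> x * y \<in> \<m>"
  using ideal_mult_left[of y x] by (simp add: mult.commute)

lemma ideal_integral: "x \<in> \<m> \<Longrightarrow> x \<in> carrier R"
  by (auto simp: ideal_iff)

lemma R_cring: "cring R"
proof (rule cringI)
  show "abelian_group R"
  proof (rule abelian_groupI)
    fix x assume "x \<in> carrier R"
    thus "\<exists>y\<in>carrier R. y \<oplus>\<^bsub>R\<^esub> x = \<zero>\<^bsub>R\<^esub>"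
      by (intro bexI[of _ "- x"]) auto
  qed (use integral_add in \<open>auto simp: algebra_simps\<close>)
  show "Group.comm_monoid R"
    by (rule comm_monoidI) (auto simp: algebra_simps)
qed (auto simp: algebra_simps)

sublocale R: cring R
  by (rule R_cring)

lemma R_uminus [simp]: "x \<in> carrier R \<Longrightarrow> \<ominus>\<^bsub>R\<^esub> x = - x"
  by (rule R.minus_equality) auto

lemma ideal_subgroup: "subgroup \<m> (add_monoid R)"
proof (rule subgroup.intro)
  show "\<m> \<subseteq> carrier (add_monoid R)"
    using ideal_integral by auto
  show "\<one>\<^bsub>add_monoid R\<^esub> \<in> \<m>"
    by (simp add: ideal_iff)
  show "inv\<^bsub>add_monoid R\<^esub> x \<in> \<m>" if "x \<in> \<m>" for x
    using ideal_minus[OF that] R_uminus[OF ideal_integral[OF that]] by (simp add: a_inv_def)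
  show "x \<otimes>\<^bsub>add_monoid R\<^esub> y \<in> \<m>" if "x \<in> \<m>" "y \<in> \<m>" for x y
    using ideal_add[OF that] by simp
qed

lemma valuation_ideal_ideal: "ideal \<m> R"
proof (rule idealI[OF R.ring_axioms ideal_subgroup])
  fix a x assume "a \<in> \<m>" "x \<in> carrier R"
  thus "x \<otimes>\<^bsub>R\<^esub> a \<in> \<m>" "a \<otimes>\<^bsub>R\<^esub> x \<in> \<m>"
    using ideal_mult_left ideal_mult_right by (simp_all del: R_simps(1))
qed

sublocale ideal \<m> R
  by (rule valuation_ideal_ideal)

sublocale k: cring \<k>
  unfolding residue_field_def by (rule quotient_is_cring[OF R_cring])

sublocale res: ring_hom_cring R \<k> res
  unfolding residue_field_def by (rule rcos_ring_hom_cring[OF R_cring])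

lemma residue_carrier: "carrier \<k> = res ` carrier R"
  unfolding residue_field_def FactRing_def A_RCOSETS_def' by (simp only: ring_record_simps) blast

lemma res_eq_iff:
  assumes "x \<in> carrier R" "y \<in> carrier R"
  shows "res x = res y \<longleftrightarrow> x - y \<in> \<m>"
  using R.quotient_eq_iff_same_a_r_cos[OF valuation_ideal_ideal assms] R_uminus[OF assms(2)]
  by (simp only: a_minus_def R_simps diff_conv_add_uminus)

lemma val_unit_add:
  assumes "x \<in> F" "w x = 0" "y \<in> \<m>"
  shows "w (x + y) = 0"
  using val_add_eq_min[of x y] assms by (auto simp: ideal_iff)

lemma res_simps:
  assumes "x \<in> carrier R" "y \<in> carrier R"
  shows "res x \<otimes>\<^bsub>\<k>\<^esub> res y = res (x * y)" "res x \<oplus>\<^bsub>\<k>\<^esub> res y = res (x + y)"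
    "\<ominus>\<^bsub>\<k>\<^esub> res x = res (- x)" "res x [^]\<^bsub>\<k>\<^esub> n = res (x ^ n)"
    "[n] \<cdot>\<^bsub>\<k>\<^esub> res x = res (of_nat n * x)"
proof -
  show mult: "res x \<otimes>\<^bsub>\<k>\<^esub> res y = res (x * y)"
    using res.hom_mult[OF assms] by (simp only: R_simps)
  show add: "res x \<oplus>\<^bsub>\<k>\<^esub> res y = res (x + y)"
    using res.hom_add[OF assms] by (simp only: R_simps)
  show "\<ominus>\<^bsub>\<k>\<^esub> res x = res (- x)"
    using res.hom_a_inv[OF assms(1)] R_uminus[OF assms(1)] by (simp only:)
  show "res x [^]\<^bsub>\<k>\<^esub> n = res (x ^ n)"
  proof (induction n)
    case 0
    then show ?case using res.hom_one by simp
  next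
    case (Suc n)
    have "res (x ^ n) \<otimes>\<^bsub>\<k>\<^esub> res x = res (x ^ n * x)"
      using res.hom_mult[OF integral_power assms(1)] assms(1) by (simp only: R_simps)
    with Suc show ?case by (simp add: mult.commute)
  qed
  show "[n] \<cdot>\<^bsub>\<k>\<^esub> res x = res (of_nat n * x)"
  proof (induction n)
    case 0
    then show ?case using res.hom_zero by simp
  next
    case (Suc n)
    have "of_nat n * x \<in> carrier R"
      by (intro integral_mult integral_of_nat assms)
    hence "res (of_nat n * x) \<oplus>\<^bsub>\<k>\<^esub> res x = res (of_nat n * x + x)"
      using res.hom_add[OF _ assms(1)] by (simp only: R_simps)
    with Suc show ?case by (simp add: algebra_simps)
  qed
qed

lemma res_eq_0_iff: "x \<in> carrier R \<Longrightarrow> res x = \<zero>\<^bsub>\<k>\<^esub> \<longleftrightarrow> x \<in> \<m>"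
  using res_eq_iff[of x 0] res.hom_zero by simp

text \<open>Every element of the residue field is the class of an integral element, so a node of the
  reduced equation is a system of congruences modulo the maximal ideal.  In this form it can be
  transported between fields and produced by explicit formulas.\<close>

lemma split_node_iff:
  assumes "set_weierstrass E \<subseteq> carrier R"
  shows "has_split_node \<k> (reduction F w E) \<longleftrightarrow>
    (\<exists>x\<in>carrier R. \<exists>y\<in>carrier R.
       y ^ 2 + a1 E * x * y + a3 E * y - (x ^ 3 + a2 E * x ^ 2 + a4 E * x + a6 E) \<in> \<m> \<and>
       a1 E * y - (3 * x ^ 2 + 2 * (a2 E * x) + a4 E) \<in> \<m> \<and>
       2 * y + a1 E * x + a3 E \<in> \<m> \<and>
       (\<exists>\<alpha>\<in>carrier R. \<exists>\<beta>\<in>carrier R. \<alpha> - \<beta> \<notin> \<m> \<and>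
          \<alpha> + \<beta> + a1 E \<in> \<m> \<and> \<alpha> * \<beta> + (a2 E + 3 * x) \<in> \<m>))"
proof -
  have coeffs: "a1 E \<in> carrier R" "a2 E \<in> carrier R" "a3 E \<in> carrier R" "a4 E \<in> carrier R"
      "a6 E \<in> carrier R"
    using assms by (cases E; simp del: R_simps)+
  have red: "a1 (reduction F w E) = res (a1 E)" "a2 (reduction F w E) = res (a2 E)"
      "a3 (reduction F w E) = res (a3 E)" "a4 (reduction F w E) = res (a4 E)"
      "a6 (reduction F w E) = res (a6 E)"
    by (cases E; simp add: reduction_def)+
  note [simp del] = R_simps(1)
  note [simp] = integral_intros coeffs
  show ?thesis
    unfolding has_split_node_def residue_carrier bex_simps red
    by (simp add: res_simps res_eq_iff res_eq_0_iff del: minus_add_distrib cong: bex_cong conj_cong)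
qed

text \<open>The residue characteristic divides \<open>n\<close> if and only if \<open>n\<close> lies in the maximal ideal.  For
  characteristic \<open>0\<close> this reads \<open>0 dvd n\<close>, which holds for no positive \<open>n\<close>.\<close>

lemma val_of_nat_dvd_6:
  assumes "ring_characteristic \<k> = 0 \<or> coprime (ring_characteristic \<k>) 6"
    and "n dvd 6"
  shows "w (of_nat n) = 0"
proof (rule ccontr)
  assume "w (of_nat n) \<noteq> 0"
  hence "of_nat n \<in> \<m>"
    using integral_of_nat[of n] by (simp add: ideal_iff)
  have one: "\<one>\<^bsub>\<k>\<^esub> = res 1"
    using res.hom_one by simp
  have dvd_iff: "ring_characteristic \<k> dvd m \<longleftrightarrow> of_nat m \<in> \<m>" for m
  proof -
    have "ring_characteristic \<k> dvd m \<longleftrightarrow> [m] \<cdot>\<^bsub>\<k>\<^esub> \<one>\<^bsub>\<k>\<^esub> = \<zero>\<^bsub>\<k>\<^esub>"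
      unfolding ring_characteristic_def add_pow_def
      using group.pow_eq_id[OF k.a_group, of "\<one>\<^bsub>\<k>\<^esub>" m] by simp
    also have "\<dots> \<longleftrightarrow> of_nat m \<in> \<m>"
      unfolding one using res_simps(5)[of 1 1 m] res_eq_0_iff[OF integral_of_nat] by simp
    finally show ?thesis .
  qed
  have "ring_characteristic \<k> dvd n"
    using dvd_iff \<open>of_nat n \<in> \<m>\<close> by simp
  hence "ring_characteristic \<k> = 1"
    using assms by (metis coprime_common_divisor_nat dvd_0_left_iff dvd_refl dvd_trans
        nat_dvd_1_iff_1 zero_neq_numeral)
  hence "(1::'b) \<in> \<m>"
    using dvd_iff[of 1] by simp
  thus False
    by (simp add: ideal_iff)
qed

text \<open>A root of \<open>X\<^sup>2 - c\<close> in the residue field is lifted.  Polynomials are lists of coefficients with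
  the leading one first.\<close>

lemma residue_square_root:
  assumes "algebraically_closed \<k>" and "c \<in> carrier R"
  obtains \<alpha> where "\<alpha> \<in> carrier R" "\<alpha> ^ 2 - c \<in> \<m>"
proof -
  interpret K: algebraically_closed \<k> by fact
  define P where "P = [\<one>\<^bsub>\<k>\<^esub>, \<zero>\<^bsub>\<k>\<^esub>, \<ominus>\<^bsub>\<k>\<^esub> res c]"
  have c: "res c \<in> carrier \<k>"
    using assms(2) by (rule res.hom_closed)
  have P: "P \<in> carrier (poly_ring \<k>)"
    using c by (simp add: P_def univ_poly_def polynomial_def)
  have "size (k.roots P) = 2"
    using K.roots_over_carrier[OF P] by (simp add: k.splitted_def P_def)
  then obtain a where "a \<in># k.roots P"
    by (metis multiset_nonemptyE size_empty zero_neq_numeral)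
  hence root: "k.is_root P a"
    using K.roots_mem_iff_is_root[OF P] by simp
  hence "a \<in> carrier \<k>"
    by (simp add: k.is_root_def)
  then obtain \<alpha> where \<alpha>: "\<alpha> \<in> carrier R" "a = res \<alpha>"
    unfolding residue_carrier by blast
  have "a \<otimes>\<^bsub>\<k>\<^esub> a \<ominus>\<^bsub>\<k>\<^esub> res c = \<zero>\<^bsub>\<k>\<^esub>"
    using root c \<open>a \<in> carrier \<k>\<close> by (simp add: k.is_root_def P_def numeral_2_eq_2 a_minus_def)
  hence "res \<alpha> \<otimes>\<^bsub>\<k>\<^esub> res \<alpha> = res c"
    using c \<alpha> by (simp only: k.r_right_minus_eq k.m_closed res.hom_closed)
  hence "\<alpha> * \<alpha> - c \<in> \<m>"
    using \<alpha>(1) assms(2) by (simp only: res_simps(1) res_eq_iff integral_mult)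
  with \<alpha>(1) show thesis
    using that by (simp add: power2_eq_square)
qed

end

section \<open>Changes of coordinates\<close>

text \<open>Completing the square in \<open>y\<close> leaves the cubic \<open>4 x\<^sup>3 + b2 x\<^sup>2 + 2 b4 x + b6\<close>, on which \<open>s\<close> and \<open>t\<close>
  have no influence.  So the quantities \<open>b2, b4, b6, b8\<close> transform in terms of \<open>u\<close> and \<open>r\<close> alone,
  and \<open>c4\<close> and the discriminant are the combinations from which \<open>r\<close> cancels.  For the
  discriminant this uses the relation \<open>4 b8 = b2 b6 - b4\<^sup>2\<close>.\<close>

lemma
  fixes E E' :: "'b::field weierstrass"
  assumes "u * a1 E' = a1 E + 2 * s"
    "u ^ 2 * a2 E' = a2 E - s * a1 E + 3 * r - s ^ 2"
    "u ^ 3 * a3 E' = a3 E + r * a1 E + 2 * t"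
    "u ^ 4 * a4 E' = a4 E - s * a3 E + 2 * r * a2 E - (t + r * s) * a1 E + 3 * r ^ 2 - 2 * s * t"
    "u ^ 6 * a6 E' = a6 E + r * a4 E + r ^ 2 * a2 E + r ^ 3 - t * a3 E - t ^ 2 - r * t * a1 E"
  shows c4_change: "u ^ 4 * c4 E' = c4 E"
    and discriminant_change: "u ^ 12 * discriminant E' = discriminant E"
proof -
  have b2: "u ^ 2 * b2 E' = b2 E + 12 * r"
  proof -
    have "u ^ 2 * b2 E' = (u * a1 E') ^ 2 + 4 * (u ^ 2 * a2 E')"
      unfolding b2_def by (simp add: algebra_simps eval_nat_numeral)
    thus ?thesis unfolding assms b2_def by (simp add: algebra_simps eval_nat_numeral)
  qed
  have b4: "u ^ 4 * b4 E' = b4 E + r * b2 E + 6 * r ^ 2"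
  proof -
    have "u ^ 4 * b4 E' = 2 * (u ^ 4 * a4 E') + (u * a1 E') * (u ^ 3 * a3 E')"
      unfolding b4_def by (simp add: algebra_simps eval_nat_numeral)
    thus ?thesis unfolding assms b4_def b2_def by (simp add: algebra_simps eval_nat_numeral)
  qed
  have b6: "u ^ 6 * b6 E' = b6 E + 2 * r * b4 E + r ^ 2 * b2 E + 4 * r ^ 3"
  proof -
    have "u ^ 6 * b6 E' = (u ^ 3 * a3 E') ^ 2 + 4 * (u ^ 6 * a6 E')"
      unfolding b6_def by (simp add: algebra_simps eval_nat_numeral)
    thus ?thesis unfolding assms b6_def b4_def b2_def by (simp add: algebra_simps eval_nat_numeral)
  qed
  have b8: "u ^ 8 * b8 E' = b8 E + 3 * r * b6 E + 3 * r ^ 2 * b4 E + r ^ 3 * b2 E + 3 * r ^ 4"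
  proof -
    have "u ^ 8 * b8 E' = (u * a1 E') ^ 2 * (u ^ 6 * a6 E') + 4 * (u ^ 2 * a2 E') * (u ^ 6 * a6 E')
        - (u * a1 E') * (u ^ 3 * a3 E') * (u ^ 4 * a4 E') + (u ^ 2 * a2 E') * (u ^ 3 * a3 E') ^ 2
        - (u ^ 4 * a4 E') ^ 2"
      unfolding b8_def by (simp add: algebra_simps eval_nat_numeral)
    thus ?thesis unfolding assms b8_def b6_def b4_def b2_def by (simp add: algebra_simps eval_nat_numeral)
  qed
  have "u ^ 4 * c4 E' = (u ^ 2 * b2 E') ^ 2 - 24 * (u ^ 4 * b4 E')"
    unfolding c4_def by (simp add: algebra_simps eval_nat_numeral)
  thus "u ^ 4 * c4 E' = c4 E"
    unfolding b2 b4 c4_def by (simp add: algebra_simps eval_nat_numeral)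
  have "u ^ 12 * discriminant E' = - ((u ^ 2 * b2 E') ^ 2) * (u ^ 8 * b8 E')
      - 8 * (u ^ 4 * b4 E') ^ 3 - 27 * (u ^ 6 * b6 E') ^ 2
      + 9 * (u ^ 2 * b2 E') * (u ^ 4 * b4 E') * (u ^ 6 * b6 E')"
    unfolding discriminant_def by (simp add: algebra_simps eval_nat_numeral)
  \<comment> \<open>the multiple of the relation is found by comparing the coefficients of \<open>b8 E\<close>\<close>
  also have "\<dots> = discriminant E - (6 * r * b2 E + 36 * r ^ 2) * (4 * b8 E - b2 E * b6 E + b4 E ^ 2)"
    unfolding b2 b4 b6 b8 discriminant_def by (simp add: algebra_simps eval_nat_numeral)
  also have "4 * b8 E - b2 E * b6 E + b4 E ^ 2 = 0"
    unfolding b8_def b6_def b4_def b2_def by (simp add: algebra_simps eval_nat_numeral)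
  finally show "u ^ 12 * discriminant E' = discriminant E"
    by simp
qed

lemma isomorphic_overE:
  assumes "isomorphic_over F E E'"
  obtains u where "u \<in> F" "u \<noteq> 0" "u ^ 4 * c4 E' = c4 E" "u ^ 12 * discriminant E' = discriminant E"
  using assms c4_change[of _ E' E] discriminant_change[of _ E' E]
  unfolding isomorphic_over_def by (metis DiffD1 DiffD2 singletonI)

lemma j_invariant_isomorphic:
  assumes "isomorphic_over F E E'"
  shows "j_invariant E' = j_invariant E"
proof -
  obtain u where u: "u \<noteq> 0" "c4 E = u ^ 4 * c4 E'" "discriminant E = u ^ 12 * discriminant E'"
    using isomorphic_overE[OF assms] by metis
  show ?thesis
    using u(1) unfolding j_invariant_def u(2,3) by (simp add: power_mult_distrib flip: power_mult)
qed

section \<open>Nodes and minimal equations\<close>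

context valued_subfield
begin

lemma integral_c4: "set_weierstrass E \<subseteq> carrier R \<Longrightarrow> c4 E \<in> carrier R"
  by (cases E) (auto simp add: c4_def b2_def b4_def intro!: integral_intros simp del: R_simps(1))

lemma integral_discriminant: "set_weierstrass E \<subseteq> carrier R \<Longrightarrow> discriminant E \<in> carrier R"
  by (cases E) (auto simp add: discriminant_def b2_def b4_def b6_def b8_def
      intro!: integral_intros simp del: R_simps(1))

text \<open>In coordinates centred at the node, the last three coefficients lie in the maximal ideal, and
  so does every term of the discriminant.  What remains of \<open>c4\<close> is the square of
  \<open>b2 = a1\<^sup>2 + 4 a2\<close>, and \<open>b2\<close> is congruent to the discriminant \<open>(\<alpha> - \<beta>)\<^sup>2\<close> of the quadratic form of
  the tangents.\<close>

lemma node_c4_discriminant: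
  assumes int: "set_weierstrass E \<subseteq> carrier R" and node: "has_split_node \<k> (reduction F w E)"
  shows "w (c4 E) = 0" and "0 < w (discriminant E)"
proof -
  note [simp del] = R_simps(1)
  note [simp] = integral_intros
  have coeffs [simp]: "a1 E \<in> carrier R" "a2 E \<in> carrier R" "a3 E \<in> carrier R" "a4 E \<in> carrier R"
      "a6 E \<in> carrier R"
    using int by (cases E; simp)+
  obtain x y \<alpha> \<beta> where [simp]: "x \<in> carrier R" "y \<in> carrier R" "\<alpha> \<in> carrier R" "\<beta> \<in> carrier R"
    and eqn: "y ^ 2 + a1 E * x * y + a3 E * y - (x ^ 3 + a2 E * x ^ 2 + a4 E * x + a6 E) \<in> \<m>"
    and dx: "a1 E * y - (3 * x ^ 2 + 2 * (a2 E * x) + a4 E) \<in> \<m>"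
    and dy: "2 * y + a1 E * x + a3 E \<in> \<m>"
    and ne: "\<alpha> - \<beta> \<notin> \<m>"
    and sum: "\<alpha> + \<beta> + a1 E \<in> \<m>" and prod: "\<alpha> * \<beta> + (a2 E + 3 * x) \<in> \<m>"
    using node unfolding split_node_iff[OF int] by blast
  define E' where "E' = Weierstrass (a1 E) (a2 E + 3 * x) (a3 E + x * a1 E + 2 * y)
    (a4 E + 2 * x * a2 E - y * a1 E + 3 * x ^ 2)
    (a6 E + x * a4 E + x ^ 2 * a2 E + x ^ 3 - y * a3 E - y ^ 2 - x * y * a1 E)"
  have E'_c4: "c4 E' = c4 E" and E'_disc: "discriminant E' = discriminant E"
    using c4_change[of 1 E' E 0 x y] discriminant_change[of 1 E' E 0 x y] by (simp_all add: E'_def)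
  have [simp]: "a1 E' \<in> carrier R" "a2 E' \<in> carrier R"
    by (simp_all add: E'_def)
  have m3: "a3 E' \<in> \<m>"
    using dy by (simp add: E'_def algebra_simps)
  have m4: "a4 E' \<in> \<m>"
    using ideal_minus[OF dx] by (simp add: E'_def algebra_simps)
  have m6: "a6 E' \<in> \<m>"
    using ideal_minus[OF eqn] by (simp add: E'_def algebra_simps)
  note [simp] = m3[THEN ideal_integral] m4[THEN ideal_integral] m6[THEN ideal_integral]
  have m: "b4 E' \<in> \<m>" "b6 E' \<in> \<m>" "b8 E' \<in> \<m>"
    using m3 m4 m6 by (auto simp: b4_def b6_def b8_def power2_eq_square
        intro!: ideal_add ideal_diff ideal_mult_left)
  have [simp]: "b2 E' \<in> carrier R"
    by (simp add: b2_def)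
  note [simp] = m[THEN ideal_integral]
  have "discriminant E' \<in> \<m>"
    using m by (auto simp: discriminant_def power2_eq_square power3_eq_cube
        intro!: ideal_add ideal_diff ideal_minus ideal_mult_left)
  thus "0 < w (discriminant E)"
    by (simp add: E'_disc ideal_iff)
  \<comment> \<open>\<open>p\<close> and \<open>q\<close> are the errors in the congruences for the slopes, \<open>z\<close> the resulting error in \<open>b2\<close>\<close>
  define p where "p = \<alpha> + \<beta> + a1 E"
  define q where "q = \<alpha> * \<beta> + (a2 E + 3 * x)"
  define z where "z = p * (p - 2 * (\<alpha> + \<beta>)) + 4 * q"
  have [simp]: "p \<in> carrier R" by (simp add: p_def)
  have z: "z \<in> \<m>"
    using sum prod unfolding z_def p_def[symmetric] q_def[symmetric]
    by (intro ideal_add ideal_mult_left ideal_mult_right) auto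
  note [simp] = z[THEN ideal_integral]
  have b2: "b2 E' = (\<alpha> - \<beta>) ^ 2 + z"
    by (simp add: b2_def E'_def z_def p_def q_def power2_eq_square algebra_simps)
  have "c4 E = (\<alpha> - \<beta>) ^ 4 + (z * (2 * (\<alpha> - \<beta>) ^ 2 + z) - 24 * b4 E')"
    unfolding E'_c4[symmetric] c4_def[of E'] b2 by (simp add: eval_nat_numeral algebra_simps)
  moreover have "z * (2 * (\<alpha> - \<beta>) ^ 2 + z) - 24 * b4 E' \<in> \<m>"
    by (intro ideal_diff ideal_mult_left[of 24] ideal_mult_right m z) auto
  moreover have "w (\<alpha> - \<beta>) = 0" "\<alpha> - \<beta> \<in> F"
    using ne integral_diff[OF \<open>\<alpha> \<in> carrier R\<close> \<open>\<beta> \<in> carrier R\<close>]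
    unfolding ideal_iff R_simps(1) by auto
  ultimately show "w (c4 E) = 0"
    by (simp add: val_unit_add)
qed

lemma val_j_neg:
  assumes "split_multiplicative_reduction F w E" "elliptic_curve E"
  shows "w (j_invariant E) < 0"
proof -
  obtain E' where iso: "isomorphic_over F E E'" and int: "set_weierstrass E' \<subseteq> carrier R"
    and node: "has_split_node \<k> (reduction F w E')"
    using assms(1)
    unfolding split_multiplicative_reduction_def minimal_model_def integral_model_def by blast
  have "discriminant E' \<noteq> 0"
    using isomorphic_overE[OF iso] assms(2) unfolding elliptic_curve_def by (metis mult_zero_right)
  moreover have "c4 E' \<in> F" "discriminant E' \<in> F"
    using integral_c4[OF int] integral_discriminant[OF int] by simp_all
  ultimately have "w (j_invariant E') = - w (discriminant E')"
    unfolding j_invariant_def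
    using node_c4_discriminant[OF int node] by (simp add: val_divide)
  thus ?thesis
    using node_c4_discriminant(2)[OF int node] j_invariant_isomorphic[OF iso]
    by (cases "w (discriminant E')") auto
qed

text \<open>Between two equations of one curve, \<open>c4\<close> and \<open>\<Delta>\<close> change by the fourth and the twelfth power of
  the same factor.  An integral equation cannot have a \<open>c4\<close> of smaller valuation than a unit, so it
  cannot have a discriminant of smaller valuation either.\<close>

lemma minimal_modelI:
  assumes "integral_model F w E E'" and "w (c4 E') = 0"
  shows "minimal_model F w E E'"
  unfolding minimal_model_def
proof (intro conjI allI impI)
  fix E'' assume E'': "integral_model F w E E''"
  have int: "set_weierstrass E' \<subseteq> carrier R" "set_weierstrass E'' \<subseteq> carrier R"
    using assms E'' by (auto simp: integral_model_def)
  obtain u where u: "u \<in> F" "u \<noteq> 0" "u ^ 4 * c4 E' = c4 E" "u ^ 12 * discriminant E' = discriminant E"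
    using assms(1) isomorphic_overE[of F E E'] unfolding integral_model_def by blast
  obtain t where t: "t \<in> F" "t \<noteq> 0" "t ^ 4 * c4 E'' = c4 E" "t ^ 12 * discriminant E'' = discriminant E"
    using E'' isomorphic_overE[of F E E''] unfolding integral_model_def by blast
  obtain m :: int where m: "w u = ereal m"
    using val_int u by blast
  obtain n :: int where n: "w t = ereal n"
    using val_int t by blast
  have "w (u ^ 4 * c4 E') = w (t ^ 4 * c4 E'')"
    using u t by simp
  hence "ereal (4 * m) = ereal (4 * n) + w (c4 E'')"
    using u(1) t(1) m n assms(2) integral_c4[OF int(1)] integral_c4[OF int(2)] by simp
  moreover have "0 \<le> w (c4 E'')"
    using integral_c4[OF int(2)] by simp
  ultimately have "n \<le> m"
    by (cases "w (c4 E'')") auto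
  have "w (u ^ 12 * discriminant E') = w (t ^ 12 * discriminant E'')"
    using u t by simp
  hence "ereal (12 * m) + w (discriminant E') = ereal (12 * n) + w (discriminant E'')"
    using u(1) t(1) m n integral_discriminant[OF int(1)] integral_discriminant[OF int(2)] by simp
  with \<open>n \<le> m\<close> show "w (discriminant E') \<le> w (discriminant E'')"
    by (cases "w (discriminant E')"; cases "w (discriminant E'')") auto
qed (rule assms(1))

text \<open>The double root of \<open>x\<^sup>3 + A x + B\<close> modulo the maximal ideal is \<open>x = -3 B / (2 A)\<close>: subtracting
  \<open>x / 3\<close> times the derivative leaves the linear remainder \<open>2 A x / 3 + B\<close>.  The slopes at the node
  are \<open>\<plusminus>\<surd>(3 x)\<close>; they are different because \<open>2\<close>, \<open>3\<close> and \<open>x\<close> are units.\<close>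

lemma short_split_node:
  assumes closed: "algebraically_closed \<k>" and two: "w 2 = 0" and three: "w 3 = 0"
    and AB [simp]: "A \<in> F" "w A = 0" "B \<in> F" "w B = 0" and disc: "4 * A ^ 3 + 27 * B ^ 2 \<in> \<m>"
  shows "has_split_node \<k> (reduction F w (Weierstrass 0 0 0 A B))"
proof -
  have [simp]: "(2::'b) \<noteq> 0" "A \<noteq> 0"
    using two AB val_0 by (metis PInfty_neq_ereal(1) zero_ereal_def)+
  have [simp]: "(4::'b) \<noteq> 0" "(8::'b) \<noteq> 0" "(16::'b) \<noteq> 0"
    using power_not_zero[of "2::'b" 2] power_not_zero[of "2::'b" 3]
      power_not_zero[of "2::'b" 4] by simp_all
  define h where "h = 1 / (2 * A)"
  have h [simp]: "h \<in> F" "w h = 0"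
    using two by (simp_all add: h_def val_divide del: divide_closed) simp_all
  define x where "x = - 3 * B * h"
  have x [simp]: "x \<in> F" "w x = 0"
    using three by (simp_all add: x_def)
  obtain \<alpha> where \<alpha>: "\<alpha> \<in> carrier R" "\<alpha> ^ 2 - 3 * x \<in> \<m>"
    using residue_square_root[OF closed, of "3 * x"] three by auto
  have "w (3 * x + (\<alpha> ^ 2 - 3 * x)) = 0"
    using val_unit_add[of "3 * x", OF _ _ \<alpha>(2)] three by simp
  hence "w \<alpha> = 0"
    using \<alpha>(1) by (cases "w \<alpha>") auto
  hence "\<alpha> - - \<alpha> \<notin> \<m>"
    using \<alpha>(1) two val_mult[of 2 \<alpha>] by (simp add: ideal_iff)
  moreover have "- (x ^ 3 + A * x + B) \<in> \<m>"
  proof -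
    have "- (x ^ 3 + A * x + B) = (h ^ 3 * B) * (4 * A ^ 3 + 27 * B ^ 2)"
      by (simp add: x_def h_def field_simps eval_nat_numeral)
    thus ?thesis using disc ideal_mult_left[of "h ^ 3 * B"] by simp
  qed
  moreover have "- (3 * x ^ 2 + A) \<in> \<m>"
  proof -
    have "- (3 * x ^ 2 + A) = (- (h ^ 2)) * (4 * A ^ 3 + 27 * B ^ 2)"
      by (simp add: x_def h_def field_simps eval_nat_numeral)
    thus ?thesis using disc ideal_mult_left[of "- (h ^ 2)"] by simp
  qed
  moreover have "\<alpha> * - \<alpha> + 3 * x \<in> \<m>"
    using ideal_minus[OF \<alpha>(2)] by (simp add: power2_eq_square)
  ultimately have "\<exists>\<alpha>\<in>carrier R. \<exists>\<beta>\<in>carrier R. \<alpha> - \<beta> \<notin> \<m> \<and> \<alpha> + \<beta> + 0 \<in> \<m> \<and> \<alpha> * \<beta> + (0 + 3 * x) \<in> \<m>"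
      and "- (x ^ 3 + A * x + B) \<in> \<m>" "- (3 * x ^ 2 + A) \<in> \<m>"
    using \<alpha>(1) by - (rule bexI[of _ \<alpha>], rule bexI[of _ "- \<alpha>"], simp_all add: ideal_iff)
  moreover have int: "set_weierstrass (Weierstrass 0 0 0 A B) \<subseteq> carrier R"
    by simp
  ultimately show ?thesis
    unfolding split_node_iff[OF int]
    by - (rule bexI[of _ x], rule bexI[of _ 0], simp_all add: ideal_iff)
qed

end

section \<open>Adjoining a square root of a uniformizer\<close>

lemma to_ac_eq_0_iff: "to_ac (a::'a::field) = 0 \<longleftrightarrow> a = 0"
proof
  assume "to_ac a = 0"
  hence "to_ac (a * inverse a) = 0" unfolding to_ac_mult by simp
  thus "a = 0" by (metis right_inverse to_ac_1 zero_neq_one)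
qed simp

text \<open>The elements of \<open>K(\<surd>\<pi>)\<close> are the combinations \<open>a + b \<surd>\<pi>\<close>.  Their valuation is defined through
  the norm rather than as a minimum, because the norm makes it multiplicative.\<close>

locale uniformizer_square_root = valued_subfield "UNIV :: 'a::field set" v for v +
  fixes \<pi> :: 'a and s :: "'a alg_closure"
  assumes uniformizer: "v \<pi> = 1" and square: "s ^ 2 = to_ac \<pi>"
begin

definition pair :: "'a \<Rightarrow> 'a \<Rightarrow> 'a alg_closure" where
  "pair a b = to_ac a + to_ac b * s"

definition relative_norm :: "'a \<Rightarrow> 'a \<Rightarrow> 'a" where
  "relative_norm a b = a ^ 2 - \<pi> * b ^ 2"

definition L :: "'a alg_closure set" where
  "L = {pair a b | a b. True}"

text \<open>The coordinates \<open>a\<close> and \<open>b\<close> are unique (lemma \<open>pair_inject\<close>), so the description is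
  meaningful on \<open>L\<close>.\<close>

definition val_L :: "'a alg_closure \<Rightarrow> ereal" where
  "val_L x = (THE r. \<exists>a b. x = pair a b \<and> r = v (relative_norm a b))"

lemma s_square: "s * s = to_ac \<pi>"
  using square by (simp add: power2_eq_square)

lemma pair_simps:
  "pair a b + pair c d = pair (a + c) (b + d)"
  "- pair a b = pair (- a) (- b)"
  "pair a b - pair c d = pair (a - c) (b - d)"
  "pair a b * pair c d = pair (a * c + \<pi> * (b * d)) (a * d + b * c)"
proof -
  show "pair a b * pair c d = pair (a * c + \<pi> * (b * d)) (a * d + b * c)"
    using s_square by (simp add: pair_def algebra_simps flip: s_square)
qed (simp_all add: pair_def algebra_simps)

lemma pair_to_ac: "pair a 0 = to_ac a"
  by (simp add: pair_def)

lemma pair_s: "pair 0 1 = s"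
  by (simp add: pair_def)

lemma pair_conjugate: "pair a b * pair a (- b) = to_ac (relative_norm a b)"
  by (simp add: pair_simps relative_norm_def power2_eq_square flip: pair_to_ac)

text \<open>For nonzero \<open>a\<close> and \<open>b\<close> the valuation of \<open>a\<^sup>2\<close> is even and that of \<open>\<pi> b\<^sup>2\<close> is odd, so the two
  terms cannot cancel.\<close>

lemma val_relative_norm: "v (relative_norm a b) = min (v (a ^ 2)) (v (\<pi> * b ^ 2))"
proof (cases "a = 0 \<or> b = 0")
  case True
  thus ?thesis by (auto simp: relative_norm_def simp del: val_mult val_power)
next
  case False
  obtain m :: int where m: "v a = ereal m" using val_int[of a] False by auto
  obtain n :: int where n: "v b = ereal n" using val_int[of b] False by auto
  have "2 * m \<noteq> 1 + 2 * n" by presburger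
  hence "v (a ^ 2) \<noteq> v (\<pi> * b ^ 2)"
    using m n uniformizer by (simp add: one_ereal_def)
  hence "v (a ^ 2 + - (\<pi> * b ^ 2)) = min (v (a ^ 2)) (v (- (\<pi> * b ^ 2)))"
    by (intro val_add_eq_min) (simp_all del: val_mult val_power)
  thus ?thesis by (simp add: relative_norm_def del: val_mult val_power)
qed

lemma \<pi>_nonzero: "\<pi> \<noteq> 0"
  using uniformizer by auto

lemma relative_norm_eq_0_iff: "relative_norm a b = 0 \<longleftrightarrow> a = 0 \<and> b = 0"
proof -
  have "relative_norm a b = 0 \<longleftrightarrow> v (relative_norm a b) = \<infinity>" by simp
  also have "\<dots> \<longleftrightarrow> v (a ^ 2) = \<infinity> \<and> v (\<pi> * b ^ 2) = \<infinity>"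
    unfolding val_relative_norm by (simp only: min_def) auto
  also have "\<dots> \<longleftrightarrow> a = 0 \<and> b = 0"
    using \<pi>_nonzero by (simp del: val_mult val_power)
  finally show ?thesis .
qed

text \<open>A vanishing element has a vanishing norm, and the norm form has no nontrivial zero.  In
  particular \<open>\<pi>\<close> is not a square in the ground field.\<close>

lemma pair_eq_0_iff: "pair a b = 0 \<longleftrightarrow> a = 0 \<and> b = 0"
proof
  assume "pair a b = 0"
  hence "to_ac (relative_norm a b) = 0" by (simp flip: pair_conjugate)
  thus "a = 0 \<and> b = 0" by (simp add: to_ac_eq_0_iff relative_norm_eq_0_iff)
qed (simp add: pair_def)

lemma pair_inject: "pair a b = pair c d \<longleftrightarrow> a = c \<and> b = d"
  using pair_eq_0_iff[of "a - c" "b - d"] by (simp flip: pair_simps)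

lemma val_L_pair: "val_L (pair a b) = v (relative_norm a b)"
  unfolding val_L_def by (rule the_equality) (auto simp: pair_inject)

lemma pair_in_L [simp]: "pair a b \<in> L"
  by (auto simp: L_def)

lemma subfield_L: "subfield L ring_of_type_algebra"
proof (rule subfield_of_typeI)
  fix x assume "x \<in> L" "x \<noteq> 0"
  then obtain a b where x: "x = pair a b" by (auto simp: L_def)
  define n where "n = relative_norm a b"
  have "n \<noteq> 0"
    using \<open>x \<noteq> 0\<close> pair_eq_0_iff by (simp add: x n_def relative_norm_eq_0_iff)
  have "x * (pair a (- b) * to_ac (inverse n)) = to_ac n * to_ac (inverse n)"
    using pair_conjugate[of a b] unfolding n_def[symmetric] x by (simp flip: mult.assoc)
  also have "\<dots> = 1"
    using \<open>n \<noteq> 0\<close> by (simp flip: to_ac_mult del: to_ac_inverse)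
  finally have "inverse x = pair a (- b) * pair (inverse n) 0"
    using inverse_unique unfolding pair_to_ac by blast
  thus "inverse x \<in> L" by (simp add: pair_simps)
next
  show "1 \<in> L" using pair_in_L[of 1 0] by (simp add: pair_to_ac)
qed (auto simp: L_def pair_simps pair_inject)

lemma val_L_mult: "x \<in> L \<Longrightarrow> y \<in> L \<Longrightarrow> val_L (x * y) = val_L x + val_L y"
proof -
  have "relative_norm (a * c + \<pi> * (b * d)) (a * d + b * c) = relative_norm a b * relative_norm c d"
    for a b c d by (simp add: relative_norm_def power2_eq_square algebra_simps)
  thus "x \<in> L \<Longrightarrow> y \<in> L \<Longrightarrow> ?thesis"
    by (auto simp: L_def pair_simps val_L_pair)
qed

text \<open>The valuation of the norm is a minimum of valuations of squares, up to the factor \<open>\<pi>\<close>, so the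
  ultrametric inequality on \<open>L\<close> reduces to one for squares.\<close>

lemma val_square_add_ge: "min (v (a ^ 2)) (v (c ^ 2)) \<le> v ((a + c) ^ 2)"
proof -
  have "v (x ^ 2) = v x + v x" for x by (simp add: power2_eq_square del: val_power)
  moreover have "v a \<le> v (a + c) \<or> v c \<le> v (a + c)"
    using val_add_ge[of a c] by (auto simp: min_le_iff_disj)
  ultimately show ?thesis
    by (auto simp: min_le_iff_disj intro: add_mono)
qed

lemma val_L_add:
  assumes "x \<in> L" "y \<in> L"
  shows "min (val_L x) (val_L y) \<le> val_L (x + y)"
proof -
  obtain a b c d where xy: "x = pair a b" "y = pair c d"
    using assms by (auto simp: L_def)
  have "min (v (\<pi> * b ^ 2)) (v (\<pi> * d ^ 2)) \<le> v (\<pi> * (b + d) ^ 2)"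
    using val_square_add_ge[of b d] add_left_mono[of _ _ "v \<pi>"]
    by (auto simp: min_le_iff_disj simp del: val_power)
  with val_square_add_ge[of a c] show ?thesis
    unfolding xy pair_simps val_L_pair val_relative_norm
    by (auto simp: min_le_iff_disj simp del: val_power val_mult)
qed

lemma val_L_to_ac: "val_L (to_ac x) = ereal 2 * v x"
  using val_L_pair[of x 0] by (simp add: pair_to_ac relative_norm_def)

lemma normalized_val_L: "normalized_valuation_on L val_L"
  unfolding normalized_valuation_on_def
proof (intro conjI ballI val_L_mult val_L_add)
  fix x assume "x \<in> L"
  thus "val_L x = \<infinity> \<longleftrightarrow> x = 0"
    by (auto simp: L_def val_L_pair relative_norm_eq_0_iff pair_eq_0_iff)
next
  show "val_L ` (L - {0}) = range (\<lambda>n::int. ereal (real_of_int n))"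
  proof (intro equalityI subsetI)
    fix r assume "r \<in> val_L ` (L - {0})"
    then obtain x where "r = val_L x" "x \<in> L" "x \<noteq> 0"
      by blast
    moreover from this obtain a b where "x = pair a b"
      by (auto simp: L_def)
    ultimately have r: "r = v (relative_norm a b)" "pair a b \<noteq> 0"
      by (simp_all add: val_L_pair)
    hence "relative_norm a b \<noteq> 0"
      by (simp add: relative_norm_eq_0_iff pair_eq_0_iff)
    thus "r \<in> range (\<lambda>n::int. ereal (real_of_int n))"
      using val_int[of "relative_norm a b"] r by auto
  next
    fix r assume "r \<in> range (\<lambda>n::int. ereal (real_of_int n))"
    then obtain n :: int where r: "r = ereal n" by blast
    obtain c where c: "c \<noteq> 0" "v c = ereal (n div 2)"
      using element_of_val by blast
    \<comment> \<open>even values are taken on the ground field, odd ones on its multiples of \<open>\<surd>\<pi>\<close>\<close>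
    define x where "x = (if even n then pair c 0 else pair 0 c)"
    have "x \<in> L - {0}"
      using c by (simp add: x_def pair_eq_0_iff)
    moreover have "val_L x = r"
    proof (cases "even n")
      case True
      hence "2 * (n div 2) = n" by simp
      hence "2 * real_of_int (n div 2) = n" by linarith
      thus ?thesis using True c by (simp add: x_def pair_to_ac val_L_to_ac r)
    next
      case False
      hence "1 + 2 * (n div 2) = n" by presburger
      hence "1 + 2 * real_of_int (n div 2) = n" by linarith
      thus ?thesis
        using False c uniformizer
        by (simp add: x_def val_L_pair r relative_norm_def one_ereal_def)
    qed
    ultimately show "r \<in> val_L ` (L - {0})" by blast
  qed
qed auto

text \<open>The ramification index is \<open>2\<close>.\<close>

lemma extends_val_L: "extends_valuation v L val_L"
  unfolding extends_valuation_def
  using normalized_val_L val_L_to_ac by (auto intro!: exI[of _ "2::nat"])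

lemma finite_extension_L: "finite_extension L"
  unfolding finite_extension_def
proof (intro conjI subfield_L)
  show "range to_ac \<subseteq> L"
    by (auto simp flip: pair_to_ac)
  interpret T: field "ring_of_type_algebra :: 'a alg_closure ring"
    by (rule field_from_type_algebra)
  have sub: "subfield (range (to_ac :: 'a \<Rightarrow> 'a alg_closure)) ring_of_type_algebra"
  proof (rule subfield_of_typeI)
    show "(1 :: 'a alg_closure) \<in> range to_ac" using to_ac_1 by (metis rangeI)
  qed (auto simp flip: to_ac_add to_ac_minus to_ac_mult to_ac_inverse)
  have "x \<in> T.Span (range to_ac) [1, s] \<longleftrightarrow> (\<exists>a b. x = to_ac a + to_ac b * s)" for x
    by (auto simp: T.line_extension_mem_iff Bex_def)
  hence "T.Span (range to_ac) [1, s] = L"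
    by (auto simp: L_def pair_def)
  thus "T.finite_dimension (range (to_ac :: 'a \<Rightarrow> 'a alg_closure)) L"
    using T.Span_finite_dimension[OF sub, of "[1, s]"] by simp
qed

sublocale L: valued_subfield L val_L
  by (rule valued_subfield.intro[OF subfield_L normalized_val_L])

end

section \<open>Curves whose invariant has negative valuation\<close>

text \<open>Completing the square in \<open>y\<close> and the cube in \<open>x\<close>.  The parameters of the change of coordinates
  are kept because it will be composed with a scaling that is defined only over the extension.\<close>

lemma obtain_short_model:
  fixes E :: "'b::field weierstrass"
  assumes "(2::'b) \<noteq> 0" "(3::'b) \<noteq> 0"
  obtains r s t A B where
    "a1 E + 2 * s = 0" "a2 E - s * a1 E + 3 * r - s ^ 2 = 0" "a3 E + r * a1 E + 2 * t = 0"
    "a4 E - s * a3 E + 2 * r * a2 E - (t + r * s) * a1 E + 3 * r ^ 2 - 2 * s * t = A"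
    "a6 E + r * a4 E + r ^ 2 * a2 E + r ^ 3 - t * a3 E - t ^ 2 - r * t * a1 E = B"
    "c4 E = - 48 * A" "discriminant E = - 16 * (4 * A ^ 3 + 27 * B ^ 2)"
proof -
  define s where "s = - a1 E / 2"
  define r where "r = (s * a1 E - a2 E + s ^ 2) / 3"
  define t where "t = - (a3 E + r * a1 E) / 2"
  define A where "A = a4 E - s * a3 E + 2 * r * a2 E - (t + r * s) * a1 E + 3 * r ^ 2 - 2 * s * t"
  define B where "B = a6 E + r * a4 E + r ^ 2 * a2 E + r ^ 3 - t * a3 E - t ^ 2 - r * t * a1 E"
  have eqs: "a1 E + 2 * s = 0" "a2 E - s * a1 E + 3 * r - s ^ 2 = 0" "a3 E + r * a1 E + 2 * t = 0"
  proof -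
    have "2 * s = - a1 E" "3 * r = s * a1 E - a2 E + s ^ 2" "2 * t = - (a3 E + r * a1 E)"
      using assms by (simp_all add: s_def r_def t_def)
    thus "a1 E + 2 * s = 0" "a2 E - s * a1 E + 3 * r - s ^ 2 = 0" "a3 E + r * a1 E + 2 * t = 0"
      by simp_all
  qed
  let ?E' = "Weierstrass 0 0 0 A B"
  have "c4 ?E' = c4 E" "discriminant ?E' = discriminant E"
    using c4_change[of 1 ?E' E s r t] discriminant_change[of 1 ?E' E s r t] eqs
    by (simp_all add: A_def B_def)
  moreover have "c4 ?E' = - 48 * A" "discriminant ?E' = - 16 * (4 * A ^ 3 + 27 * B ^ 2)"
    by (simp_all add: c4_def discriminant_def b2_def b4_def b6_def b8_def algebra_simps
        eval_nat_numeral)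
  ultimately show thesis
    using that eqs A_def B_def by simp
qed

lemma c4_to_ac: "c4 (map_weierstrass to_ac E) = to_ac (c4 E)"
  by (simp add: c4_def b2_def b4_def weierstrass.map_sel)

lemma discriminant_to_ac: "discriminant (map_weierstrass to_ac E) = to_ac (discriminant E)"
  by (simp add: discriminant_def b2_def b4_def b6_def b8_def weierstrass.map_sel)

context uniformizer_square_root
begin

lemma to_ac_in_L [simp]: "to_ac x \<in> L"
  using pair_in_L[of x 0] by (simp add: pair_to_ac)

lemma to_ac_integral_iff: "to_ac x \<in> carrier L.R \<longleftrightarrow> x \<in> carrier R"
  by (cases "v x") (simp_all add: val_L_to_ac)

lemma to_ac_ideal_iff: "to_ac x \<in> L.\<m> \<longleftrightarrow> x \<in> \<m>"
  by (cases "v x") (simp_all add: ideal_iff L.ideal_iff val_L_to_ac)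

text \<open>Congruences between elements of the ground field stay valid, and noncongruences too, since the
  valuation of the extension is a positive multiple of the given one.\<close>

lemma split_node_to_ac:
  assumes int: "set_weierstrass E \<subseteq> carrier R" and node: "has_split_node \<k> (reduction UNIV v E)"
  shows "has_split_node L.\<k> (reduction L val_L (map_weierstrass to_ac E))"
proof -
  have int_L: "set_weierstrass (map_weierstrass to_ac E) \<subseteq> carrier L.R"
    using int unfolding weierstrass.set_map by (auto simp only: to_ac_integral_iff)
  obtain x y \<alpha> \<beta> where int: "x \<in> carrier R" "y \<in> carrier R" "\<alpha> \<in> carrier R" "\<beta> \<in> carrier R"
    and eqs: "y ^ 2 + a1 E * x * y + a3 E * y - (x ^ 3 + a2 E * x ^ 2 + a4 E * x + a6 E) \<in> \<m>"
      "a1 E * y - (3 * x ^ 2 + 2 * (a2 E * x) + a4 E) \<in> \<m>" "2 * y + a1 E * x + a3 E \<in> \<m>"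
      "\<alpha> - \<beta> \<notin> \<m>" "\<alpha> + \<beta> + a1 E \<in> \<m>" "\<alpha> * \<beta> + (a2 E + 3 * x) \<in> \<m>"
    using node unfolding split_node_iff[OF int] by blast
  show ?thesis
    unfolding L.split_node_iff[OF int_L] weierstrass.map_sel
    using int[folded to_ac_integral_iff] eqs[folded to_ac_ideal_iff]
    unfolding to_ac_add to_ac_diff to_ac_mult to_ac_power to_ac_numeral by blast
qed

text \<open>The scaling by \<open>u = (\<surd>\<pi>)\<^sup>m\<close> turns the short equation of \<open>E\<close> into one with unit coefficients in
  the ground field, whose node is found by \<open>short_split_node\<close>.\<close>

lemma split_multiplicative:
  assumes "algebraically_closed \<k>" and two: "v 2 = 0" and three: "v 3 = 0"
    and E: "elliptic_curve E" and j: "v (j_invariant E) < 0"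
  shows "split_multiplicative_reduction L val_L (map_weierstrass to_ac E)"
proof -
  have nz: "(2::'a) \<noteq> 0" "(3::'a) \<noteq> 0"
    using two three by auto
  obtain r q t A B where short:
    "a1 E + 2 * q = 0" "a2 E - q * a1 E + 3 * r - q ^ 2 = 0" "a3 E + r * a1 E + 2 * t = 0"
    "a4 E - q * a3 E + 2 * r * a2 E - (t + r * q) * a1 E + 3 * r ^ 2 - 2 * q * t = A"
    "a6 E + r * a4 E + r ^ 2 * a2 E + r ^ 3 - t * a3 E - t ^ 2 - r * t * a1 E = B"
    and c4: "c4 E = - 48 * A" and disc: "discriminant E = - 16 * (4 * A ^ 3 + 27 * B ^ 2)"
    using obtain_short_model[OF nz, of E] by metis
  define D where "D = 4 * A ^ 3 + 27 * B ^ 2"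
  have v4: "v 4 = 0" using val_power[of 2 2] two by simp
  have v16: "v 16 = 0" using val_power[of 2 4] two by simp
  have v27: "v 27 = 0" using val_power[of 3 3] three by simp
  have v48: "v 48 = 0" using val_mult[of 16 3] v16 three by simp
  have D: "D \<noteq> 0"
    using E unfolding elliptic_curve_def disc D_def by (metis mult_zero_right)
  have A: "A \<noteq> 0"
    using j by (auto simp: j_invariant_def c4)
  obtain d :: int where d: "v D = ereal d"
    using val_int[of D] D by auto
  obtain a :: int where a: "v A = ereal a"
    using val_int[of A] A by auto
  have "v (c4 E) = ereal a"
    using val_minus[of "48 * A"] v48 a by (simp add: c4)
  moreover have vdisc: "v (discriminant E) = ereal d"
    using val_minus[of "16 * D"] v16 d by (simp add: disc flip: D_def)
  moreover have "discriminant E \<noteq> 0"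
    using E by (simp add: elliptic_curve_def)
  ultimately have "3 * a < d"
    using j by (simp add: j_invariant_def val_divide)
  have "v (4 * A ^ 3) = ereal (3 * a)"
    using v4 a by simp
  \<comment> \<open>\<open>27 B\<^sup>2 = D - 4 A\<^sup>3\<close>, and the second term has the smaller valuation\<close>
  hence "v (D + - (4 * A ^ 3)) = ereal (3 * a)"
    using val_add_eq_min[of D "- (4 * A ^ 3)"] d \<open>3 * a < d\<close> val_minus[of "4 * A ^ 3"] by simp
  hence "v (27 * B ^ 2) = ereal (3 * a)"
    by (simp add: D_def del: val_mult val_power)
  hence B': "ereal 2 * v B = ereal (3 * a)"
    using v27 by simp
  hence "B \<noteq> 0" by auto
  then obtain b :: int where b: "v B = ereal b"
    using val_int[of B] by auto
  \<comment> \<open>\<open>2 b = 3 a\<close> is solved by \<open>a = 2 m\<close>, \<open>b = 3 m\<close>\<close>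
  define m where "m = b - a"
  have "2 * b = 3 * a"
    using B' b by simp
  hence ab: "a = 2 * m" "b = 3 * m"
    by (simp_all add: m_def)
  define p where "p = \<pi> powi m"
  have p: "p \<noteq> 0" "v p = ereal m"
    using val_power_int[of \<pi> 1 m] \<pi>_nonzero uniformizer by (simp_all add: p_def one_ereal_def)
  define A' where "A' = A / p ^ 2"
  define B' where "B' = B / p ^ 3"
  have vA': "v A' = 0" and vB': "v B' = 0"
    using p a b ab by (simp_all add: A'_def B'_def val_divide)
  have "4 * A' ^ 3 + 27 * B' ^ 2 = D / p ^ 6"
    using p(1) by (simp add: A'_def B'_def D_def field_simps)
  hence "v (4 * A' ^ 3 + 27 * B' ^ 2) = ereal (d - 3 * a)"
    using p d ab by (simp add: val_divide)
  hence D': "4 * A' ^ 3 + 27 * B' ^ 2 \<in> \<m>"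
    using \<open>3 * a < d\<close> by (simp add: ideal_iff)
  let ?E1 = "Weierstrass 0 0 0 A' B'"
  have int: "set_weierstrass ?E1 \<subseteq> carrier R"
    using vA' vB' by simp
  have int_L: "set_weierstrass (map_weierstrass to_ac ?E1) \<subseteq> carrier L.R"
    using int unfolding weierstrass.set_map by (auto simp only: to_ac_integral_iff)
  define u where "u = s powi m"
  have s: "s \<noteq> 0" "s \<in> L"
    using square \<pi>_nonzero pair_in_L[of 0 1] by (auto simp: pair_s to_ac_eq_0_iff)
  have u2: "u ^ 2 = to_ac p"
  proof -
    have "u ^ 2 = (s ^ 2) powi m"
      by (simp add: u_def power2_eq_square power_int_mult_distrib)
    thus ?thesis
      by (simp add: square p_def power_int_def to_ac_inverse)
  qed
  have u4: "u ^ 4 * to_ac A' = to_ac A" and u6: "u ^ 6 * to_ac B' = to_ac B"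
  proof -
    have "u ^ 4 = to_ac (p ^ 2)" "u ^ 6 = to_ac (p ^ 3)"
      using power_mult[of u 2 2] power_mult[of u 2 3] by (simp_all add: u2)
    thus "u ^ 4 * to_ac A' = to_ac A" "u ^ 6 * to_ac B' = to_ac B"
      using p(1) by (simp_all add: A'_def B'_def to_ac_eq_0_iff)
  qed
  have u: "u \<in> L - {0}"
    using s by (simp add: u_def power_int_eq_0_iff)
  have iso: "isomorphic_over L (map_weierstrass to_ac E) (map_weierstrass to_ac ?E1)"
    unfolding isomorphic_over_def
    by (rule bexI[of _ u], rule bexI[of _ "to_ac r"], rule bexI[of _ "to_ac q"],
        rule bexI[of _ "to_ac t"])
      (use short[THEN arg_cong[of _ _ to_ac]] u4 u6 u in \<open>auto simp: weierstrass.map_sel\<close>)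
  have "has_split_node \<k> (reduction UNIV v ?E1)"
    using short_split_node[OF assms(1) two three _ vA' _ vB' D'] by simp
  hence node: "has_split_node L.\<k> (reduction L val_L (map_weierstrass to_ac ?E1))"
    using split_node_to_ac int by blast
  have "minimal_model L val_L (map_weierstrass to_ac E) (map_weierstrass to_ac ?E1)"
    using iso int_L L.node_c4_discriminant(1)[OF int_L node]
    by (intro L.minimal_modelI) (auto simp only: integral_model_def)
  with node show ?thesis
    unfolding split_multiplicative_reduction_def by blast
qed

end

theorem corollary7p1:
  fixes v :: "'a::field_char_0 \<Rightarrow> ereal" and E :: "'a weierstrass"
  assumes "normalized_valuation_on UNIV v"
    and "complete_valuation v"
    and "algebraically_closed (residue_field UNIV v)"
    and "ring_characteristic (residue_field UNIV v) = 0 \<or>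
         coprime (ring_characteristic (residue_field UNIV v)) 6"
    and "elliptic_curve E"
  shows "(\<exists>L w. finite_extension L \<and> extends_valuation v L w \<and>
            split_multiplicative_reduction L w (map_weierstrass to_ac E)) \<longleftrightarrow>
         v (j_invariant E) < 0"
proof
  interpret valued_subfield "UNIV :: 'a set" v
    by (rule valued_subfield.intro[OF subfield_of_typeI assms(1)]) auto
  {
    assume "\<exists>L w. finite_extension L \<and> extends_valuation v L w \<and>
      split_multiplicative_reduction L w (map_weierstrass to_ac E)"
    then obtain L w where L: "finite_extension L" "extends_valuation v L w"
      and split: "split_multiplicative_reduction L w (map_weierstrass to_ac E)" by blast
    interpret L: valued_subfield L w
      using L by (auto simp: valued_subfield_def finite_extension_def extends_valuation_def)
    have "elliptic_curve (map_weierstrass to_ac E)"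
      using assms(5) by (simp add: elliptic_curve_def discriminant_to_ac to_ac_eq_0_iff)
    hence "w (j_invariant (map_weierstrass to_ac E)) < 0"
      by (rule L.val_j_neg[OF split])
    moreover have "j_invariant (map_weierstrass to_ac E) = to_ac (j_invariant E)"
      by (simp add: j_invariant_def discriminant_to_ac c4_to_ac)
    moreover obtain e :: nat where "0 < e" "\<And>x. w (to_ac x) = ereal (real e) * v x"
      using L(2) unfolding extends_valuation_def by blast
    ultimately show "v (j_invariant E) < 0"
      by (cases "v (j_invariant E)") (auto simp: mult_less_0_iff)
  }
  assume j: "v (j_invariant E) < 0"
  obtain \<pi> where \<pi>: "v \<pi> = 1"
    using element_of_val[of 1] by (auto simp: one_ereal_def)
  obtain s where s: "s ^ 2 = to_ac \<pi>"
    using nth_root_exists[of 2 "to_ac \<pi>"] by auto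
  interpret uniformizer_square_root v \<pi> s
    using \<pi> s
    by (intro uniformizer_square_root.intro uniformizer_square_root_axioms.intro
        valued_subfield_axioms)
  have "v 2 = 0" "v 3 = 0"
    using val_of_nat_dvd_6[OF assms(4), of 2] val_of_nat_dvd_6[OF assms(4), of 3] by simp_all
  from split_multiplicative[OF assms(3) this assms(5) j]
  show "\<exists>L w. finite_extension L \<and> extends_valuation v L w \<and>
      split_multiplicative_reduction L w (map_weierstrass to_ac E)"
    using finite_extension_L extends_val_L by blast
qed

end
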